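(* Let $\mathcal R_0$ be the internal unequal crossover recombinator on $\mathcal M_1^+$, $$\mathcal R_0(p)_i=\sum_{\substack{k,\ell\ge 0\\ \min\{k,\ell\}\le i\le \max\{k,\ell\}}}\frac{p_k\,p_\ell}{1+|k-\ell|},\qquad i\in\mathbb N_0 .$$ Let $p(0)\in\mathcal M_1^+$ and assume that for some fixed $r>1$ the $r$-th moment exists, $\sum_{k\ge0}k^r p_k(0)<\infty$. Then $m=\sum_{k\ge0}k\,p_k(0)$ is finite, and, both for the discrete-time dynamics $p(t+1)=\mathcal R_0(p(t))$, $t\in\mathbb N_0$, and for the continuous-time dynamics $\frac{d}{dt}p(t)=\mathcal R_0(p(t))-p(t)$, $t\ge 0$, one has $\lim_{t\to\infty}\|p(t)-p\|_1=0$, where $p\in\mathcal M_1^+$ is given by $p_{\lfloor m\rfloor}=\lfloor m\rfloor+1-m$, $p_{\lceil m\rceil}=m+1-\lceil m\rceil$, and $p_k=0$ for all other $k$ (if $m$ is an integer, this means $p_m=1$).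
   Context: $\mathcal M_1^+$ denotes the set of probability measures on $\mathbb N_0=\{0,1,2,\dots\}$, identified with sequences $p=(p_k)_{k\in\mathbb N_0}$ with $p_k\ge0$ and $\sum_k p_k=1$, viewed as a subset of $\ell^1(\mathbb N_0)$ with norm $\|x\|_1=\sum_{k\ge0}|x_k|$ (the total variation norm). The continuous-time equation is an ODE in the Banach space $\ell^1(\mathbb N_0)$ with initial value $p(0)$. *)

theory Defs
  imports "HOL-Analysis.Analysis"
begin

definition in_l1 :: "(nat \<Rightarrow> real) \<Rightarrow> bool" where
  "in_l1 x \<longleftrightarrow> summable (\<lambda>k. \<bar>x k\<bar>)"

definition l1norm :: "(nat \<Rightarrow> real) \<Rightarrow> real" where
  "l1norm x = (\<Sum>k. \<bar>x k\<bar>)"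

definition prob_seq :: "(nat \<Rightarrow> real) \<Rightarrow> bool" where
  "prob_seq p \<longleftrightarrow> (\<forall>k. p k \<ge> 0) \<and> summable p \<and> (\<Sum>k. p k) = 1"

definition R0 :: "(nat \<Rightarrow> real) \<Rightarrow> (nat \<Rightarrow> real)" where
  "R0 p i = infsum (\<lambda>(k, l). p k * p l / (1 + \<bar>real k - real l\<bar>))
              {(k, l). min k l \<le> i \<and> i \<le> max k l}"

definition has_l1_derivative ::
  "(real \<Rightarrow> nat \<Rightarrow> real) \<Rightarrow> (nat \<Rightarrow> real) \<Rightarrow> real \<Rightarrow> bool" where
  "has_l1_derivative p D t \<longleftrightarrow>
     ((\<lambda>s. l1norm (\<lambda>k. (p s k - p t k) / (s - t) - D k)) \<longlongrightarrow> 0) (at t within {0..})"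

text \<open>The limit measure concentrated on floor m and ceiling m with mean m.\<close>
definition limit_dist :: "real \<Rightarrow> nat \<Rightarrow> real" where
  "limit_dist m k =
     (if \<lfloor>m\<rfloor> = \<lceil>m\<rceil> then (if real k = m then 1 else 0)
      else if real_of_int \<lfloor>m\<rfloor> = real k then real_of_int \<lfloor>m\<rfloor> + 1 - m
      else if real_of_int \<lceil>m\<rceil> = real k then m + 1 - real_of_int \<lceil>m\<rceil>
      else 0)"

end

theory Submission
  imports Defs
begin

text \<open>
  Recombination replaces a pair \<open>k, l\<close> by a uniform point between them. This preserves the mean
  and raises the expectation of every concave function, in particular the truncated means
  \<open>\<phi>\<^sub>c(p) = \<Sum>\<^sub>k min(k, c) p\<^sub>k\<close>. The gain is explicit:
  \<open>\<phi>\<^sub>c(R\<^sub>0 p) - \<phi>\<^sub>c(p) = \<Sum> p\<^sub>k p\<^sub>l (c - k)(l - c) / (1 + l - k)\<close>, the sum being over \<open>k < c < l\<close>.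
  Since \<open>\<phi>\<^sub>c \<le> c\<close> along the dynamics, the gain becomes arbitrarily small. It controls the product
  \<open>(c - \<phi>\<^sub>c)(m - \<phi>\<^sub>c) = E (c - k)\<^sup>+ \<cdot> E (k - c)\<^sup>+\<close> up to a tail \<open>m - \<phi>\<^sub>K\<close>, which is largest at time \<open>0\<close>.
  Hence \<open>\<phi>\<^sub>c\<close> increases to \<open>min(c, m)\<close>, and the weights are second differences of
  \<open>c \<mapsto> \<phi>\<^sub>c\<close>. In continuous time one shows first that a solution stays a probability vector
  (Gronwall's inequality for its total mass and for its negative part) and that its mean is conserved.
\<close>

section \<open>Absolutely summable sequences\<close>

lemma in_l1_iff_summable_on: "in_l1 x \<longleftrightarrow> x summable_on UNIV"
proof -
  have "summable (\<lambda>k. \<bar>x k\<bar>) \<longleftrightarrow> (\<lambda>k. \<bar>x k\<bar>) summable_on UNIV"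
    by (simp add: summable_on_UNIV_nonneg_real_iff)
  also have "\<dots> \<longleftrightarrow> x summable_on UNIV"
    by (simp add: summable_on_iff_abs_summable_on_real[of x])
  finally show ?thesis by (simp add: in_l1_def)
qed

lemma summable_on_abs_real:
  fixes x :: "'a \<Rightarrow> real"
  assumes "x summable_on A"
  shows "(\<lambda>k. \<bar>x k\<bar>) summable_on A"
  using assms summable_on_iff_abs_summable_on_real[of x A] by simp

lemma summable_on_diff_real:
  fixes x y :: "'a \<Rightarrow> real"
  assumes "x summable_on A" "y summable_on A"
  shows "(\<lambda>k. x k - y k) summable_on A"
  using summable_on_add[OF assms(1) summable_on_uminus[THEN iffD2, OF assms(2)]] by simp

lemma infsum_diff_real:
  fixes x y :: "'a \<Rightarrow> real"
  assumes "x summable_on A" "y summable_on A"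
  shows "(\<Sum>\<^sub>\<infinity>k\<in>A. x k - y k) = (\<Sum>\<^sub>\<infinity>k\<in>A. x k) - (\<Sum>\<^sub>\<infinity>k\<in>A. y k)"
  using infsum_add[OF assms(1) summable_on_uminus[THEN iffD2, OF assms(2)]]
  by (simp add: infsum_uminus)

lemma l1norm_eq_infsum:
  assumes "x summable_on UNIV"
  shows "l1norm x = (\<Sum>\<^sub>\<infinity>k. \<bar>x k\<bar>)"
proof -
  have "((\<lambda>k. \<bar>x k\<bar>) has_sum (\<Sum>\<^sub>\<infinity>k. \<bar>x k\<bar>)) UNIV"
    using summable_on_abs_real[OF assms] by simp
  from has_sum_imp_sums[OF this] show ?thesis
    by (simp add: l1norm_def sums_iff)
qed

lemma l1norm_nonneg: "x summable_on UNIV \<Longrightarrow> 0 \<le> l1norm x"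
  by (simp add: l1norm_eq_infsum infsum_nonneg)

lemma prob_seq_iff_has_sum: "prob_seq p \<longleftrightarrow> (\<forall>k. 0 \<le> p k) \<and> (p has_sum 1) UNIV"
proof (cases "\<forall>k. 0 \<le> p k")
  case True
  then have "p sums 1 \<longleftrightarrow> (p has_sum 1) UNIV"
    using sums_nonneg_imp_has_sum[of p 1] has_sum_imp_sums[of p 1] by blast
  with True show ?thesis by (auto simp: prob_seq_def sums_iff)
qed (auto simp: prob_seq_def)

lemma summable_on_bounded_mult:
  fixes x f :: "'a \<Rightarrow> real"
  assumes "x summable_on A" and "\<And>i. i \<in> A \<Longrightarrow> \<bar>f i\<bar> \<le> C"
  shows "(\<lambda>i. f i * x i) summable_on A"
proof -
  have "(\<lambda>i. C * \<bar>x i\<bar>) summable_on A"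
    using summable_on_abs_real[OF assms(1)] by (rule summable_on_cmult_right)
  then have "(\<lambda>i. norm (f i * x i)) summable_on A"
    by (rule Infinite_Sum.abs_summable_on_comparison_test')
       (auto simp: abs_mult intro!: mult_right_mono assms(2))
  then show ?thesis
    using summable_on_iff_abs_summable_on_real by blast
qed

lemma has_sum_product_real:
  fixes f :: "'a \<Rightarrow> real" and g :: "'b \<Rightarrow> real"
  assumes f: "(f has_sum a) A" and g: "(g has_sum b) B"
  shows "((\<lambda>(x, y). f x * g y) has_sum a * b) (A \<times> B)"
proof -
  have sf: "(\<lambda>x. \<bar>f x\<bar>) summable_on A" and sg: "(\<lambda>x. \<bar>g x\<bar>) summable_on B"
    using f g by (auto intro: summable_on_abs_real has_sum_imp_summable)
  have "(\<lambda>w. norm (case w of (x, y) \<Rightarrow> f x * g y)) summable_on A \<times> B"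
  proof (rule summable_on_SigmaI)
    show "((\<lambda>y. norm (case (x, y) of (x, y) \<Rightarrow> f x * g y)) has_sum \<bar>f x\<bar> * (\<Sum>\<^sub>\<infinity>y\<in>B. \<bar>g y\<bar>)) B" for x
      using has_sum_cmult_right[OF has_sum_infsum[OF sg]] by (simp add: abs_mult)
    show "(\<lambda>x. \<bar>f x\<bar> * (\<Sum>\<^sub>\<infinity>y\<in>B. \<bar>g y\<bar>)) summable_on A"
      using sf by (rule summable_on_cmult_left)
  qed simp
  then have "(\<lambda>(x, y). f x * g y) summable_on A \<times> B"
    using summable_on_iff_abs_summable_on_real by blast
  then have "((\<lambda>(x, y). f x * g y) has_sum infsum (\<lambda>(x, y). f x * g y) (A \<times> B)) (A \<times> B)"
    by simp
  moreover from has_sum_SigmaD[OF this, of "\<lambda>x. f x * b"]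
  have "((\<lambda>x. f x * b) has_sum infsum (\<lambda>(x, y). f x * g y) (A \<times> B)) A"
    using g by (auto intro: has_sum_cmult_right)
  ultimately show ?thesis
    using has_sum_cmult_left[OF f, of b] has_sum_unique by metis
qed

section \<open>The recombinator as a kernel on pairs\<close>

definition crossover_kernel :: "nat \<Rightarrow> nat \<times> nat \<Rightarrow> real" where
  "crossover_kernel i = (\<lambda>(k, l).
     if min k l \<le> i \<and> i \<le> max k l then 1 / (1 + \<bar>real k - real l\<bar>) else 0)"

definition interval_mean :: "(nat \<Rightarrow> real) \<Rightarrow> nat \<times> nat \<Rightarrow> real" where
  "interval_mean f = (\<lambda>(k, l). (\<Sum>i = min k l..max k l. f i) / (1 + \<bar>real k - real l\<bar>))"

definition recombine :: "(nat \<times> nat \<Rightarrow> real) \<Rightarrow> nat \<Rightarrow> real" where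
  "recombine x i = (\<Sum>\<^sub>\<infinity>z. x z * crossover_kernel i z)"

lemma crossover_kernel_nonneg: "0 \<le> crossover_kernel i z"
  by (auto simp: crossover_kernel_def split: prod.split)

lemma crossover_kernel_le_1: "crossover_kernel i z \<le> 1"
  by (auto simp: crossover_kernel_def split: prod.split)

lemma R0_eq_recombine: "R0 p = recombine (\<lambda>(k, l). p k * p l)"
proof
  fix i
  show "R0 p i = recombine (\<lambda>(k, l). p k * p l) i"
    unfolding R0_def recombine_def
    by (rule infsum_cong_neutral) (auto simp: crossover_kernel_def split: if_splits)
qed

lemma has_sum_interval_mean:
  "((\<lambda>i. f i * crossover_kernel i z) has_sum interval_mean f z) UNIV"
proof -
  obtain k l where z: "z = (k, l)" by fastforce
  show ?thesis
    by (rule has_sum_finite_neutralI[of "{min k l..max k l}"])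
       (auto simp: z crossover_kernel_def interval_mean_def sum_divide_distrib)
qed

lemma interval_mean_const: "interval_mean (\<lambda>_. c) z = c"
proof -
  obtain k l where z: "z = (k, l)" by fastforce
  have "real (Suc (max k l) - min k l) = 1 + \<bar>real k - real l\<bar>"
    by (cases "k \<le> l") auto
  then have "real (card {min k l..max k l}) = 1 + \<bar>real k - real l\<bar>"
    by simp
  then show ?thesis
    by (simp add: z interval_mean_def del: card_atLeastAtMost)
qed

lemma interval_mean_mono:
  assumes "\<And>i. f i \<le> g i"
  shows "interval_mean f z \<le> interval_mean g z"
  by (auto simp: interval_mean_def assms sum_mono divide_right_mono split: prod.split)

lemma abs_interval_mean_le:
  assumes "\<And>i. \<bar>f i\<bar> \<le> C"
  shows "\<bar>interval_mean f z\<bar> \<le> C"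
  using interval_mean_mono[of f "\<lambda>_. C" z] interval_mean_mono[of "\<lambda>_. -C" f z] assms
  by (simp add: interval_mean_const abs_le_iff) (metis minus_le_iff)

lemma recombine_has_sum:
  assumes x: "x summable_on UNIV" and f: "\<And>i. \<bar>f i\<bar> \<le> C"
  shows "((\<lambda>i. f i * recombine x i) has_sum (\<Sum>\<^sub>\<infinity>z. x z * interval_mean f z)) UNIV"
proof -
  define G where "G = (\<lambda>(z, i). x z * (f i * crossover_kernel i z))"
  have hsG: "((\<lambda>i. G (z, i)) has_sum x z * interval_mean f z) UNIV" for z
    unfolding G_def using has_sum_cmult_right[OF has_sum_interval_mean[of f z], of "x z"] by simp
  have "(\<lambda>w. norm (G w)) summable_on UNIV \<times> UNIV"
  proof (rule summable_on_SigmaI)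
    show "((\<lambda>i. norm (G (z, i))) has_sum \<bar>x z\<bar> * interval_mean (\<lambda>i. \<bar>f i\<bar>) z) UNIV" for z
      unfolding G_def using has_sum_interval_mean[of "\<lambda>i. \<bar>f i\<bar>" z]
      by (auto simp: abs_mult crossover_kernel_nonneg intro: has_sum_cmult_right)
    have "(\<lambda>z. interval_mean (\<lambda>i. \<bar>f i\<bar>) z * \<bar>x z\<bar>) summable_on UNIV"
      by (rule summable_on_bounded_mult[OF summable_on_abs_real[OF x], of _ C],
          rule abs_interval_mean_le) (simp add: f)
    then show "(\<lambda>z. \<bar>x z\<bar> * interval_mean (\<lambda>i. \<bar>f i\<bar>) z) summable_on UNIV"
      by (simp add: mult.commute)
  qed simp
  then have "G summable_on UNIV \<times> UNIV"
    using summable_on_iff_abs_summable_on_real by blast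
  then have hs: "(G has_sum infsum G (UNIV \<times> UNIV)) (UNIV \<times> UNIV)" by simp
  then have "((\<lambda>z. x z * interval_mean f z) has_sum infsum G (UNIV \<times> UNIV)) UNIV"
    by (rule has_sum_SigmaD) (rule hsG)
  then have eq: "infsum G (UNIV \<times> UNIV) = (\<Sum>\<^sub>\<infinity>z. x z * interval_mean f z)"
    by (simp add: infsumI)
  have "((\<lambda>(i, z). G (z, i)) has_sum infsum G (UNIV \<times> UNIV)) (UNIV \<times> UNIV)"
    using hs by (subst (asm) has_sum_swap)
  then have "((\<lambda>i. f i * recombine x i) has_sum infsum G (UNIV \<times> UNIV)) UNIV"
  proof (rule has_sum_SigmaD)
    fix i
    have "(\<lambda>z. crossover_kernel i z * x z) summable_on UNIV"
      by (rule summable_on_bounded_mult[OF x, of _ 1])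
         (simp add: crossover_kernel_nonneg crossover_kernel_le_1)
    then have "((\<lambda>z. x z * crossover_kernel i z) has_sum recombine x i) UNIV"
      by (simp add: recombine_def mult.commute)
    then have "((\<lambda>z. f i * (x z * crossover_kernel i z)) has_sum f i * recombine x i) UNIV"
      by (rule has_sum_cmult_right)
    then show "((\<lambda>z. case (i, z) of (i, z) \<Rightarrow> G (z, i)) has_sum f i * recombine x i) UNIV"
      by (simp add: G_def mult_ac)
  qed
  with eq show ?thesis by simp
qed

lemma recombine_mono:
  assumes "x summable_on UNIV" "y summable_on UNIV" "\<And>z. x z \<le> y z"
  shows "recombine x i \<le> recombine y i"
proof -
  have *: "(\<lambda>z. x z * crossover_kernel i z) summable_on UNIV" if "x summable_on UNIV" for x
    using summable_on_bounded_mult[OF that, of "crossover_kernel i" 1]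
    by (simp add: crossover_kernel_nonneg crossover_kernel_le_1 mult.commute)
  show ?thesis
    unfolding recombine_def
    by (rule infsum_mono) (auto intro!: * assms mult_right_mono crossover_kernel_nonneg)
qed

lemma summable_on_pairs:
  fixes p :: "nat \<Rightarrow> real"
  assumes "p summable_on UNIV"
  shows "(\<lambda>(k, l). p k * p l) summable_on UNIV"
  using has_sum_imp_summable[OF has_sum_product_real[OF has_sum_infsum[OF assms] has_sum_infsum[OF assms]]]
  by simp

lemma R0_has_sum:
  assumes "p summable_on UNIV" and "\<And>i. \<bar>f i\<bar> \<le> C"
  shows "((\<lambda>i. f i * R0 p i) has_sum (\<Sum>\<^sub>\<infinity>(k, l). p k * p l * interval_mean f (k, l))) UNIV"
  using recombine_has_sum[OF summable_on_pairs[OF assms(1)] assms(2)]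
  by (simp add: R0_eq_recombine case_prod_unfold)

lemma R0_has_sum_mass:
  assumes "(p has_sum s) UNIV"
  shows "(R0 p has_sum s * s) UNIV"
  using R0_has_sum[of p "\<lambda>_. 1" 1] has_sum_product_real[OF assms assms] assms
  by (simp add: interval_mean_const has_sum_iff)

lemma R0_summable_on:
  assumes "p summable_on UNIV"
  shows "R0 p summable_on UNIV"
  using R0_has_sum_mass[of p] assms by (auto simp: summable_on_def)

lemma R0_nonneg: "(\<And>k. 0 \<le> p k) \<Longrightarrow> 0 \<le> R0 p i"
  unfolding R0_def by (rule infsum_nonneg) auto

lemma prob_seq_R0: "prob_seq p \<Longrightarrow> prob_seq (R0 p)"
  using R0_has_sum_mass[of p 1] by (auto simp: prob_seq_iff_has_sum R0_nonneg)

text \<open>Up to symmetrisation in \<open>k, l\<close>, this is twice the amount by which the uniform mean of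
  \<open>min i c\<close> over the interval between \<open>k\<close> and \<open>l\<close> exceeds the mean of its endpoint values;
  the subtractions are truncated, so it vanishes unless \<open>k < c < l\<close>.\<close>
definition crossing :: "nat \<Rightarrow> nat \<Rightarrow> nat \<Rightarrow> real" where
  "crossing c k l = real (c - k) * real (l - c) / (1 + \<bar>real k - real l\<bar>)"

lemma sum_min_interval:
  "(\<Sum>i = k..k + d. real (min i c)) =
     (1 + real d) * (real (min k c) + real (min (k + d) c)) / 2 + real (c - k) * real (k + d - c) / 2"
proof (induction d)
  case (Suc d)
  consider "c \<le> k" | "k \<le> c" "c \<le> k + d" | "k + d < c" by linarith
  then show ?case
  proof cases
    case 2
    then obtain a b where "c = k + a" "d = a + b"
      using that[of "c - k" "k + d - c"] by linarith
    with Suc show ?thesis by (simp add: field_simps)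
  next
    case 3
    then obtain a where "c = k + d + Suc a"
      using less_iff_Suc_add by auto
    with Suc show ?thesis by (simp add: field_simps)
  qed (use Suc in \<open>simp add: field_simps\<close>)
qed (cases "c \<le> k"; simp)

lemma interval_mean_min:
  "interval_mean (\<lambda>i. real (min i c)) (k, l) =
     (real (min k c) + real (min l c)) / 2 + (crossing c k l + crossing c l k) / 2"
proof -
  have *: "interval_mean (\<lambda>i. real (min i c)) (k, l) =
      (real (min k c) + real (min l c)) / 2 + (crossing c k l + crossing c l k) / 2"
    if "k \<le> l" for k l
  proof -
    from that obtain d where l: "l = k + d" using le_Suc_ex by blast
    have "real (c - l) * real (k - c) = 0" using l by auto
    then have "crossing c l k = 0" by (simp add: crossing_def)
    then show ?thesis
      by (simp add: l interval_mean_def sum_min_interval) (simp add: crossing_def field_simps)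
  qed
  show ?thesis
  proof (cases "k \<le> l")
    case False
    then have "interval_mean (\<lambda>i. real (min i c)) (k, l) = interval_mean (\<lambda>i. real (min i c)) (l, k)"
      by (simp add: interval_mean_def min.commute max.commute abs_minus_commute)
    with False *[of l k] show ?thesis by (simp add: add.commute)
  qed (rule *)
qed

lemma crossing_nonneg: "0 \<le> crossing c k l"
  by (simp add: crossing_def)

lemma crossing_le: "crossing c k l \<le> real (min l (2 * c)) - real (min l c)"
proof (cases "k < c \<and> c < l")
  case True
  then have "crossing c k l = (real c - real k) * (real l - real c) / (1 + real l - real k)"
    by (simp add: crossing_def of_nat_diff)
  moreover have "(real c - real k) * (real l - real c) \<le> (real c - real k) * (1 + real l - real k)"
    using True by (intro mult_left_mono) auto
  moreover have "(real c - real k) * (real l - real c) \<le> (1 + real l - real k) * (real l - real c)"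
    using True by (intro mult_right_mono) auto
  ultimately have "crossing c k l \<le> real c - real k" "crossing c k l \<le> real l - real c"
    using True by (simp_all add: pos_divide_le_eq mult.commute)
  with True show ?thesis by (auto simp: min_def)
qed (auto simp: crossing_def)

lemma product_le_crossing:
  "real (c - k) * real (l - c) \<le> (2 * real K + 1) * crossing c k l + 2 * real c * real (l - K)"
proof (cases "k < c \<and> c < l")
  case True
  show ?thesis
  proof (cases "l \<le> 2 * K")
    case True': True
    have "1 + \<bar>real k - real l\<bar> \<le> 2 * real K + 1"
      using True True' by linarith
    then have "real (c - k) * real (l - c) * (1 + \<bar>real k - real l\<bar>)
        \<le> real (c - k) * real (l - c) * (2 * real K + 1)"
      by (intro mult_left_mono) auto
    then have "real (c - k) * real (l - c) \<le> (2 * real K + 1) * crossing c k l"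
      by (simp add: crossing_def divide_simps mult_ac)
    moreover have "0 \<le> 2 * real c * real (l - K)" by simp
    ultimately show ?thesis by linarith
  next
    case False
    have "real (c - k) * real (l - c) \<le> real c * (2 * real (l - K))"
      using False by (intro mult_mono) auto
    moreover have "0 \<le> (2 * real K + 1) * crossing c k l"
      by (simp add: crossing_nonneg)
    ultimately show ?thesis by simp
  qed
qed (auto simp: crossing_def)

section \<open>Truncated means\<close>

definition trunc_mean :: "nat \<Rightarrow> (nat \<Rightarrow> real) \<Rightarrow> real" where
  "trunc_mean c p = (\<Sum>\<^sub>\<infinity>k. real (min k c) * p k)"

definition gain :: "nat \<Rightarrow> (nat \<Rightarrow> real) \<Rightarrow> real" where
  "gain c p = (\<Sum>\<^sub>\<infinity>(k, l). p k * p l * ((crossing c k l + crossing c l k) / 2))"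

lemma trunc_mean_has_sum:
  assumes "p summable_on UNIV"
  shows "((\<lambda>k. real (min k c) * p k) has_sum trunc_mean c p) UNIV"
  unfolding trunc_mean_def
  by (rule has_sum_infsum, rule summable_on_bounded_mult[OF assms, of _ "real c"]) auto

lemma gain_has_sum:
  assumes "p summable_on UNIV"
  shows "((\<lambda>(k, l). p k * p l * ((crossing c k l + crossing c l k) / 2)) has_sum gain c p) UNIV"
proof -
  have "(\<lambda>z. (crossing c (fst z) (snd z) + crossing c (snd z) (fst z)) / 2 *
      (case z of (k, l) \<Rightarrow> p k * p l)) summable_on UNIV"
  proof (rule summable_on_bounded_mult[OF summable_on_pairs[OF assms], of _ "real c"])
    have "crossing c k l \<le> real c" for k l
      using crossing_le[of c k l] by (auto simp: min_def split: if_splits)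
    then have "crossing c k l + crossing c l k \<le> real c * 2" for k l
      using add_mono[of "crossing c k l" "real c" "crossing c l k" "real c"] by simp
    then show "\<bar>(crossing c (fst z) (snd z) + crossing c (snd z) (fst z)) / 2\<bar> \<le> real c" for z
      by (simp add: crossing_nonneg)
  qed
  then show ?thesis
    by (simp add: gain_def case_prod_unfold mult.commute)
qed

lemma has_sum_pairs:
  fixes p :: "nat \<Rightarrow> real"
  assumes "((\<lambda>k. f k * p k) has_sum a) UNIV" "((\<lambda>l. g l * p l) has_sum b) UNIV"
  shows "((\<lambda>(k, l). p k * p l * (f k * g l)) has_sum a * b) UNIV"
  using has_sum_product_real[OF assms] by (simp add: mult_ac)

lemma has_sum_pairs_average:
  assumes "prob_seq p" and "((\<lambda>k. f k * p k) has_sum a) UNIV"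
  shows "((\<lambda>(k, l). p k * p l * ((f k + f l) / 2)) has_sum a) UNIV"
proof -
  have 1: "((\<lambda>k. 1 * p k) has_sum 1) UNIV"
    using assms(1) by (simp add: prob_seq_iff_has_sum)
  have "((\<lambda>z. 1/2 * ((case z of (k, l) \<Rightarrow> p k * p l * (f k * 1)) +
      (case z of (k, l) \<Rightarrow> p k * p l * (1 * f l)))) has_sum 1/2 * (a * 1 + 1 * a)) UNIV"
    by (intro has_sum_cmult_right has_sum_add has_sum_pairs assms 1)
  then show ?thesis
    by (simp add: case_prod_unfold distrib_left add_divide_distrib)
qed

lemma prob_seq_summable_on: "prob_seq p \<Longrightarrow> p summable_on UNIV"
  by (auto simp: prob_seq_iff_has_sum intro: has_sum_imp_summable)

lemma prob_seq_nonneg: "prob_seq p \<Longrightarrow> 0 \<le> p k"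
  by (simp add: prob_seq_def)

lemma trunc_mean_R0:
  assumes "prob_seq p"
  shows "trunc_mean c (R0 p) = trunc_mean c p + gain c p"
proof -
  note s = prob_seq_summable_on[OF assms]
  have "((\<lambda>z. (case z of (k, l) \<Rightarrow> p k * p l * ((real (min k c) + real (min l c)) / 2)) +
      (case z of (k, l) \<Rightarrow> p k * p l * ((crossing c k l + crossing c l k) / 2)))
      has_sum trunc_mean c p + gain c p) UNIV"
    by (intro has_sum_add has_sum_pairs_average gain_has_sum trunc_mean_has_sum s assms)
  then have "((\<lambda>(k, l). p k * p l * interval_mean (\<lambda>i. real (min i c)) (k, l))
      has_sum trunc_mean c p + gain c p) UNIV"
    unfolding interval_mean_min by (simp add: case_prod_unfold distrib_left)
  moreover have "((\<lambda>i. real (min i c) * R0 p i) has_sum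
      (\<Sum>\<^sub>\<infinity>(k, l). p k * p l * interval_mean (\<lambda>i. real (min i c)) (k, l))) UNIV"
    by (rule R0_has_sum[OF s, of _ "real c"]) auto
  ultimately show ?thesis
    by (simp add: trunc_mean_def infsumI)
qed

lemma gain_nonneg: "prob_seq p \<Longrightarrow> 0 \<le> gain c p"
  unfolding gain_def by (rule infsum_nonneg) (auto simp: crossing_nonneg prob_seq_nonneg)

lemma gain_le:
  assumes "prob_seq p"
  shows "gain c p \<le> trunc_mean (2 * c) p - trunc_mean c p"
proof -
  note s = prob_seq_summable_on[OF assms]
  define f where "f k = real (min k (2 * c)) - real (min k c)" for k
  have "((\<lambda>k. f k * p k) has_sum trunc_mean (2 * c) p + - trunc_mean c p) UNIV"
    using has_sum_add[OF trunc_mean_has_sum[OF s, of "2 * c"]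
        has_sum_uminusI[OF trunc_mean_has_sum[OF s, of c]]]
    by (simp add: f_def algebra_simps)
  from has_sum_pairs_average[OF assms this]
  have "gain c p \<le> trunc_mean (2 * c) p + - trunc_mean c p"
  proof (rule has_sum_mono[OF gain_has_sum[OF s]], safe)
    fix k l
    show "p k * p l * ((crossing c k l + crossing c l k) / 2) \<le> p k * p l * ((f k + f l) / 2)"
      using crossing_le[of c k l] crossing_le[of c l k]
      by (intro mult_left_mono) (auto simp: f_def prob_seq_nonneg[OF assms])
  qed
  then show ?thesis by simp
qed

lemma trunc_mean_mono:
  assumes "prob_seq p" "c \<le> d"
  shows "trunc_mean c p \<le> trunc_mean d p"
  using assms by (intro has_sum_mono[OF trunc_mean_has_sum trunc_mean_has_sum])
    (auto intro!: mult_right_mono prob_seq_nonneg prob_seq_summable_on)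

lemma trunc_mean_nonneg: "prob_seq p \<Longrightarrow> 0 \<le> trunc_mean c p"
  unfolding trunc_mean_def by (rule infsum_nonneg) (simp add: prob_seq_nonneg)

lemma trunc_mean_double_le:
  assumes "prob_seq p"
  shows "trunc_mean (2 * c) p \<le> 2 * trunc_mean c p"
proof -
  note s = prob_seq_summable_on[OF assms]
  have "real (min k (2 * c)) * p k \<le> 2 * (real (min k c) * p k)" for k
    unfolding mult.assoc[symmetric]
    by (intro mult_right_mono) (auto simp: prob_seq_nonneg[OF assms])
  then show ?thesis
    by (intro has_sum_mono[OF trunc_mean_has_sum[OF s] has_sum_cmult_right[OF trunc_mean_has_sum[OF s]]])
qed

lemma trunc_mean_le:
  assumes "prob_seq p"
  shows "trunc_mean c p \<le> real c"
proof -
  have "((\<lambda>k. real c * p k) has_sum real c * 1) UNIV"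
    using assms by (intro has_sum_cmult_right) (simp add: prob_seq_iff_has_sum)
  then have "trunc_mean c p \<le> real c * 1"
    by (rule has_sum_mono[OF trunc_mean_has_sum[OF prob_seq_summable_on[OF assms]]])
       (auto intro!: mult_right_mono prob_seq_nonneg[OF assms])
  then show ?thesis by simp
qed

lemma trunc_mean_le_mean:
  assumes "prob_seq p" and "((\<lambda>k. real k * p k) has_sum m) UNIV"
  shows "trunc_mean c p \<le> m"
  by (rule has_sum_mono[OF trunc_mean_has_sum[OF prob_seq_summable_on[OF assms(1)]] assms(2)])
     (auto intro!: mult_right_mono prob_seq_nonneg[OF assms(1)])

lemma trunc_mean_tendsto_mean:
  assumes "prob_seq p" and "((\<lambda>k. real k * p k) has_sum m) UNIV"
  shows "(\<lambda>c. trunc_mean c p) \<longlonglongrightarrow> m"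
proof (rule tendsto_sandwich)
  show "(\<lambda>c. \<Sum>k<c. real k * p k) \<longlonglongrightarrow> m"
    using has_sum_imp_sums[OF assms(2)] by (simp add: sums_def)
  show "\<forall>\<^sub>F c in sequentially. (\<Sum>k<c. real k * p k) \<le> trunc_mean c p"
  proof (rule always_eventually, rule allI)
    fix c
    have "(\<Sum>k<c. real k * p k) = (\<Sum>k<c. real (min k c) * p k)"
      by (rule sum.cong) auto
    also have "\<dots> \<le> trunc_mean c p"
      by (rule finite_sum_le_has_sum[OF trunc_mean_has_sum[OF prob_seq_summable_on[OF assms(1)]]])
         (auto simp: prob_seq_nonneg[OF assms(1)])
    finally show "(\<Sum>k<c. real k * p k) \<le> trunc_mean c p" .
  qed
qed (use trunc_mean_le_mean[OF assms] in auto)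

lemma mean_has_sum_of_trunc_mean:
  assumes "prob_seq p" and "(\<lambda>c. trunc_mean c p) \<longlonglongrightarrow> m"
  shows "((\<lambda>k. real k * p k) has_sum m) UNIV"
proof -
  have le: "trunc_mean c p \<le> m" for c
    using trunc_mean_mono[OF assms(1)] assms(2) by (intro incseq_le) (auto simp: incseq_def)
  have "(\<lambda>k. real k * p k) summable_on UNIV"
  proof (rule nonneg_bdd_above_summable_on)
    show "bdd_above (sum (\<lambda>k. real k * p k) ` {F. F \<subseteq> UNIV \<and> finite F})"
    proof (rule bdd_aboveI2)
      fix F :: "nat set" assume "F \<in> {F. F \<subseteq> UNIV \<and> finite F}"
      then have F: "finite F" by simp
      have "(\<Sum>k\<in>F. real k * p k) = (\<Sum>k\<in>F. real (min k (Max F)) * p k)"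
        by (rule sum.cong) (use F in auto)
      also have "\<dots> \<le> trunc_mean (Max F) p"
        by (rule finite_sum_le_has_sum[OF trunc_mean_has_sum[OF prob_seq_summable_on[OF assms(1)]]])
           (auto simp: prob_seq_nonneg[OF assms(1)] F)
      finally show "(\<Sum>k\<in>F. real k * p k) \<le> m" using le[of "Max F"] by simp
    qed
  qed (simp add: prob_seq_nonneg[OF assms(1)])
  then have "((\<lambda>k. real k * p k) has_sum (\<Sum>\<^sub>\<infinity>k. real k * p k)) UNIV" by simp
  moreover from trunc_mean_tendsto_mean[OF assms(1) this] assms(2)
  have "(\<Sum>\<^sub>\<infinity>k. real k * p k) = m" by (rule LIMSEQ_unique)
  ultimately show ?thesis by simp
qed

text \<open>The left-hand side is \<open>E (c - k)\<^sup>+ \<cdot> E (k - c)\<^sup>+\<close>. Pairs with \<open>l \<le> 2K\<close> are controlled by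
  the gain, the others by the tail \<open>E (k - K)\<^sup>+ = m - trunc_mean K p\<close>.\<close>
lemma deficit_product_le_gain:
  assumes p: "prob_seq p" and m: "((\<lambda>k. real k * p k) has_sum m) UNIV"
  shows "(real c - trunc_mean c p) * (m - trunc_mean c p)
    \<le> 2 * (2 * real K + 1) * gain c p + 2 * real c * (m - trunc_mean K p)"
proof -
  note s = prob_seq_summable_on[OF p]
  have p1: "((\<lambda>k. 1 * p k) has_sum 1) UNIV" using p by (simp add: prob_seq_iff_has_sum)
  have up: "((\<lambda>l. real (l - K) * p l) has_sum m - trunc_mean K p) UNIV" for K
  proof -
    have "real (l - K) * p l = real l * p l + - (real (min l K) * p l)" for l
      by (cases "l \<le> K") (auto simp: of_nat_diff left_diff_distrib)
    then show ?thesis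
      using has_sum_add[OF m has_sum_uminusI[OF trunc_mean_has_sum[OF s, of K]]] by simp
  qed
  have "real (c - k) * p k = real c * (1 * p k) + - (real (min k c) * p k)" for k
    by (cases "k \<le> c") (auto simp: of_nat_diff left_diff_distrib)
  then have dn: "((\<lambda>k. real (c - k) * p k) has_sum real c - trunc_mean c p) UNIV"
    using has_sum_add[OF has_sum_cmult_right[OF p1, of "real c"]
        has_sum_uminusI[OF trunc_mean_has_sum[OF s, of c]]]
    by simp
  have total: "((\<lambda>z. 2 * (2 * real K + 1) *
        (case z of (k, l) \<Rightarrow> p k * p l * ((crossing c k l + crossing c l k) / 2)) +
        2 * real c * (case z of (k, l) \<Rightarrow> p k * p l * (1 * real (l - K))))
      has_sum 2 * (2 * real K + 1) * gain c p + 2 * real c * (1 * (m - trunc_mean K p))) UNIV"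
    by (intro has_sum_add has_sum_cmult_right has_sum_pairs gain_has_sum s p1 up)
  have "(real c - trunc_mean c p) * (m - trunc_mean c p)
      \<le> 2 * (2 * real K + 1) * gain c p + 2 * real c * (1 * (m - trunc_mean K p))"
  proof (rule has_sum_mono[OF has_sum_pairs[OF dn up[of c]] total], safe)
    fix k l
    have "0 \<le> (2 * real K + 1) * crossing c l k" by (simp add: crossing_nonneg)
    then have "real (c - k) * real (l - c)
        \<le> (2 * real K + 1) * (crossing c k l + crossing c l k) + 2 * real c * real (l - K)"
      using product_le_crossing[of c k l K] by (simp add: distrib_left)
    then have "p k * p l * (real (c - k) * real (l - c)) \<le> p k * p l *
        ((2 * real K + 1) * (crossing c k l + crossing c l k) + 2 * real c * real (l - K))"
      by (intro mult_left_mono) (simp_all add: prob_seq_nonneg[OF p])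
    then show "p k * p l * (real (c - k) * real (l - c))
        \<le> 2 * (2 * real K + 1) * (p k * p l * ((crossing c k l + crossing c l k) / 2)) +
           2 * real c * (p k * p l * (1 * real (l - K)))"
      by (simp add: field_simps)
  qed
  then show ?thesis by simp
qed

lemma mean_R0:
  assumes p: "prob_seq p" and m: "((\<lambda>k. real k * p k) has_sum m) UNIV"
  shows "((\<lambda>k. real k * R0 p k) has_sum m) UNIV"
proof (rule mean_has_sum_of_trunc_mean[OF prob_seq_R0[OF p]])
  have lim: "(\<lambda>c. trunc_mean c p) \<longlonglongrightarrow> m"
    by (rule trunc_mean_tendsto_mean[OF assms])
  show "(\<lambda>c. trunc_mean c (R0 p)) \<longlonglongrightarrow> m"
  proof (rule tendsto_sandwich[OF always_eventually always_eventually lim]; (rule allI)?)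
    show "(\<lambda>c. trunc_mean (2 * c) p) \<longlonglongrightarrow> m"
      using LIMSEQ_subseq_LIMSEQ[OF lim, of "(*) 2"] by (simp add: strict_mono_def o_def)
    show "trunc_mean c p \<le> trunc_mean c (R0 p)" "trunc_mean c (R0 p) \<le> trunc_mean (2 * c) p" for c
      using gain_nonneg[OF p, of c] gain_le[OF p, of c] by (simp_all add: trunc_mean_R0[OF p])
  qed
qed

section \<open>Convergence to the limit measure\<close>

lemma limit_dist_eq_hat:
  assumes "0 \<le> m"
  shows "limit_dist m k = max 0 (1 - \<bar>real k - m\<bar>)"
proof (cases "m = of_int \<lfloor>m\<rfloor>")
  case True
  then obtain j where m: "m = of_int j" by blast
  have "1 \<le> \<bar>real k - m\<bar>" if "real k \<noteq> m"
  proof -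
    have "int k \<noteq> j" using that m by auto
    then have "1 \<le> \<bar>int k - j\<bar>" by linarith
    then have "1 \<le> \<bar>real_of_int (int k - j)\<bar>" by linarith
    then show ?thesis by (simp add: m)
  qed
  then show ?thesis
    by (auto simp: limit_dist_def m)
next
  case False
  then have c: "\<lceil>m\<rceil> = \<lfloor>m\<rfloor> + 1" by (metis Ints_of_int ceiling_altdef)
  have fl: "of_int \<lfloor>m\<rfloor> < m" "m < of_int \<lfloor>m\<rfloor> + 1"
    using False floor_correct[of m] by linarith+
  consider "int k < \<lfloor>m\<rfloor>" | "int k = \<lfloor>m\<rfloor>" | "int k = \<lfloor>m\<rfloor> + 1" | "\<lfloor>m\<rfloor> + 1 < int k" by linarith
  then show ?thesis
  proof cases
    case 1
    then have "real k + 1 \<le> of_int \<lfloor>m\<rfloor>" by linarith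
    with fl show ?thesis by (simp add: limit_dist_def c)
  next
    case 2
    then have "real k = of_int \<lfloor>m\<rfloor>" by (metis of_int_of_nat_eq)
    then have "limit_dist m k = of_int \<lfloor>m\<rfloor> + 1 - m" by (simp add: limit_dist_def c)
    with \<open>real k = of_int \<lfloor>m\<rfloor>\<close> fl show ?thesis by linarith
  next
    case 3
    then have "real k = of_int \<lfloor>m\<rfloor> + 1" by (metis of_int_of_nat_eq of_int_add of_int_1)
    with fl show ?thesis by (simp add: limit_dist_def c)
  next
    case 4
    then have k: "of_int \<lfloor>m\<rfloor> + 2 \<le> real k" by linarith
    then have "limit_dist m k = 0" by (simp add: limit_dist_def c)
    with k fl show ?thesis by linarith
  qed
qed

lemma limit_dist_finite_support:
  assumes "0 \<le> m" and "k \<notin> {nat \<lfloor>m\<rfloor>, Suc (nat \<lfloor>m\<rfloor>)}"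
  shows "limit_dist m k = 0"
proof -
  from assms have "int k \<noteq> \<lfloor>m\<rfloor>" "int k \<noteq> \<lfloor>m\<rfloor> + 1" by auto
  then consider "int k + 1 \<le> \<lfloor>m\<rfloor>" | "\<lfloor>m\<rfloor> + 2 \<le> int k" by linarith
  then show ?thesis
    unfolding limit_dist_eq_hat[OF assms(1)] using floor_correct[of m] by cases linarith+
qed

lemma prob_seq_limit_dist:
  assumes "0 \<le> m"
  shows "prob_seq (limit_dist m)"
  unfolding prob_seq_iff_has_sum
proof (intro conjI allI)
  define n where "n = nat \<lfloor>m\<rfloor>"
  have n: "real n \<le> m" "m < real n + 1" using assms floor_correct[of m] by (auto simp: n_def)
  show "(limit_dist m has_sum 1) UNIV"
  proof (rule has_sum_finite_neutralI[of "{n, Suc n}"])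
    show "1 = sum (limit_dist m) {n, Suc n}"
      using n by (simp add: limit_dist_eq_hat[OF assms])
  qed (use limit_dist_finite_support[OF assms] in \<open>auto simp: n_def\<close>)
qed (simp add: limit_dist_eq_hat[OF assms])

lemma l1norm_diff_le:
  assumes p: "prob_seq p" and q: "prob_seq q" and S: "finite S" "\<And>k. k \<notin> S \<Longrightarrow> q k = 0"
  shows "l1norm (\<lambda>k. p k - q k) \<le> 2 * (\<Sum>k\<in>S. \<bar>p k - q k\<bar>)"
proof -
  have "((\<lambda>k. p k + - q k) has_sum 1 + - 1) UNIV"
    using p q by (intro has_sum_add has_sum_uminusI) (auto simp: prob_seq_iff_has_sum)
  then have d: "((\<lambda>k. p k - q k) has_sum 0) UNIV" by simp
  have "((\<lambda>k. max 0 (q k - p k)) has_sum (\<Sum>k\<in>S. max 0 (q k - p k))) UNIV"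
    using S prob_seq_nonneg[OF p] by (intro has_sum_finite_neutralI[of S]) auto
  then have "((\<lambda>k. (p k - q k) + 2 * max 0 (q k - p k)) has_sum
      0 + 2 * (\<Sum>k\<in>S. max 0 (q k - p k))) UNIV"
    by (intro has_sum_add has_sum_cmult_right d)
  moreover have "(p k - q k) + 2 * max 0 (q k - p k) = \<bar>p k - q k\<bar>" for k
    by (cases "q k \<le> p k") auto
  ultimately have "((\<lambda>k. \<bar>p k - q k\<bar>) has_sum 2 * (\<Sum>k\<in>S. max 0 (q k - p k))) UNIV" by simp
  then have "l1norm (\<lambda>k. p k - q k) = 2 * (\<Sum>k\<in>S. max 0 (q k - p k))"
    using l1norm_eq_infsum[OF has_sum_imp_summable[OF d]] by (simp add: infsumI)
  also have "\<dots> \<le> 2 * (\<Sum>k\<in>S. \<bar>p k - q k\<bar>)"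
    by (intro mult_left_mono sum_mono) auto
  finally show ?thesis .
qed

lemma prob_seq_eq_trunc_mean_diff:
  assumes "prob_seq p"
  shows "p k = (if k = 0 then 1 else trunc_mean k p - trunc_mean (k - 1) p)
           - (trunc_mean (Suc k) p - trunc_mean k p)"
proof -
  note tm = trunc_mean_has_sum[OF prob_seq_summable_on[OF assms]]
  have single: "((\<lambda>j. of_bool (j = k) * p j) has_sum p k) UNIV"
    by (rule has_sum_finite_neutralI[of "{k}"]) auto
  have "((\<lambda>j. of_bool (j = k) * p j) has_sum
      (if k = 0 then 1 else trunc_mean k p - trunc_mean (k - 1) p)
           - (trunc_mean (Suc k) p - trunc_mean k p)) UNIV"
  proof (cases k)
    case 0
    have "(p has_sum 1) UNIV" using assms by (simp add: prob_seq_iff_has_sum)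
    from has_sum_add[OF this has_sum_uminusI[OF tm[of 1]]]
    have "((\<lambda>j. p j + - (real (min j 1) * p j)) has_sum 1 + - trunc_mean 1 p) UNIV" .
    moreover have "p j + - (real (min j 1) * p j) = of_bool (j = k) * p j" for j
      by (cases j) (auto simp: 0)
    moreover have "trunc_mean 0 p = 0" by (simp add: trunc_mean_def)
    ultimately show ?thesis by (simp add: 0)
  next
    case (Suc b)
    have "((\<lambda>j. 2 * (real (min j k) * p j) + (- (real (min j b) * p j) + - (real (min j (Suc k)) * p j)))
        has_sum 2 * trunc_mean k p + (- trunc_mean b p + - trunc_mean (Suc k) p)) UNIV"
      by (intro has_sum_add has_sum_cmult_right has_sum_uminusI tm)
    moreover have "2 * (real (min j k) * p j) + (- (real (min j b) * p j) + - (real (min j (Suc k)) * p j))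
        = of_bool (j = k) * p j" for j
    proof -
      have "2 * real (min j k) - real (min j b) - real (min j (Suc k)) = of_bool (j = k)"
        by (auto simp: Suc min_def)
      then have "(2 * real (min j k) - real (min j b) - real (min j (Suc k))) * p j = of_bool (j = k) * p j"
        by simp
      then show ?thesis by (simp only: algebra_simps)
    qed
    ultimately show ?thesis by (simp add: Suc)
  qed
  with single show ?thesis by (rule has_sum_unique)
qed

lemma limit_dist_eq_min_diff:
  assumes "0 \<le> m"
  shows "limit_dist m k = (if k = 0 then 1 else min (real k) m - min (real (k - 1)) m)
           - (min (real (Suc k)) m - min (real k) m)"
  unfolding limit_dist_eq_hat[OF assms] using assms by (cases k) (auto simp: min_def max_def)

theorem tendsto_limit_dist:
  fixes P :: "'a::linorder \<Rightarrow> nat \<Rightarrow> real"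
  assumes prob: "\<And>t. a \<le> t \<Longrightarrow> prob_seq (P t)"
    and mean: "\<And>t. a \<le> t \<Longrightarrow> ((\<lambda>k. real k * P t k) has_sum m) UNIV"
    and mono: "\<And>c s t. a \<le> s \<Longrightarrow> s \<le> t \<Longrightarrow> trunc_mean c (P s) \<le> trunc_mean c (P t)"
    and small: "\<And>c \<delta>. 0 < \<delta> \<Longrightarrow> \<exists>t\<ge>a. gain c (P t) < \<delta>"
  shows "((\<lambda>t. l1norm (\<lambda>k. P t k - limit_dist m k)) \<longlongrightarrow> 0) at_top"
proof -
  have m: "0 \<le> m"
    by (rule has_sum_nonneg[OF mean[OF order_refl]]) (simp add: prob_seq_nonneg[OF prob])
  have tm: "((\<lambda>t. trunc_mean c (P t)) \<longlongrightarrow> min (real c) m) at_top" for c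
  proof (rule tendstoI)
    fix e :: real assume e: "0 < e"
    have "(\<lambda>K. 2 * real c * (m - trunc_mean K (P a))) \<longlonglongrightarrow> 2 * real c * (m - m)"
      by (intro tendsto_intros trunc_mean_tendsto_mean prob mean order_refl)
    then have "\<forall>\<^sub>F K in sequentially. 2 * real c * (m - trunc_mean K (P a)) < e\<^sup>2 / 2"
      by (rule order_tendstoD) (use e in simp)
    then obtain K where K: "2 * real c * (m - trunc_mean K (P a)) < e\<^sup>2 / 2"
      using eventually_sequentially by auto
    have "0 < e\<^sup>2 / 2 / (2 * (2 * real K + 1))" using e by simp
    then obtain s where s: "a \<le> s" "gain c (P s) < e\<^sup>2 / 2 / (2 * (2 * real K + 1))"
      using small by blast
    then have "2 * (2 * real K + 1) * gain c (P s) < e\<^sup>2 / 2"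
      by (simp add: field_simps)
    moreover have "2 * real c * (m - trunc_mean K (P s)) \<le> 2 * real c * (m - trunc_mean K (P a))"
      using mono[OF order_refl s(1), of K] by (intro mult_left_mono) auto
    ultimately have prod: "(real c - trunc_mean c (P s)) * (m - trunc_mean c (P s)) < e\<^sup>2"
      using deficit_product_le_gain[OF prob mean, OF s(1) s(1), of c K] K by linarith
    have le: "trunc_mean c (P t) \<le> min (real c) m" if "a \<le> t" for t
      using trunc_mean_le[OF prob] trunc_mean_le_mean[OF prob mean] that by simp
    have "(min (real c) m - trunc_mean c (P s))\<^sup>2
        \<le> (real c - trunc_mean c (P s)) * (m - trunc_mean c (P s))"
      unfolding power2_eq_square using le[OF s(1)] by (intro mult_mono) auto
    with prod have "(min (real c) m - trunc_mean c (P s))\<^sup>2 < e\<^sup>2" by simp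
    then have "min (real c) m - trunc_mean c (P s) < e"
      using e by (simp add: power2_less_imp_less)
    then have "dist (trunc_mean c (P t)) (min (real c) m) < e" if "s \<le> t" for t
      using mono[OF s(1) that, of c] le[of t] that s(1) by (simp add: dist_real_def)
    then show "\<forall>\<^sub>F t in at_top. dist (trunc_mean c (P t)) (min (real c) m) < e"
      by (auto simp: eventually_at_top_linorder)
  qed
  have pointwise: "((\<lambda>t. P t k) \<longlongrightarrow> limit_dist m k) at_top" for k
  proof (rule Lim_transform_eventually)
    show "\<forall>\<^sub>F t in at_top. (if k = 0 then 1 else trunc_mean k (P t) - trunc_mean (k - 1) (P t))
           - (trunc_mean (Suc k) (P t) - trunc_mean k (P t)) = P t k"
      unfolding eventually_at_top_linorder
      using prob_seq_eq_trunc_mean_diff[OF prob, symmetric] by blast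
    show "((\<lambda>t. (if k = 0 then 1 else trunc_mean k (P t) - trunc_mean (k - 1) (P t))
           - (trunc_mean (Suc k) (P t) - trunc_mean k (P t))) \<longlongrightarrow> limit_dist m k) at_top"
      unfolding limit_dist_eq_min_diff[OF m]
      by (cases "k = 0") (simp_all only: if_True if_False simp_thms, (intro tendsto_intros tm)+)
  qed
  define S where "S = {nat \<lfloor>m\<rfloor>, Suc (nat \<lfloor>m\<rfloor>)}"
  have "((\<lambda>t. 2 * (\<Sum>k\<in>S. \<bar>P t k - limit_dist m k\<bar>)) \<longlongrightarrow>
      2 * (\<Sum>k\<in>S. \<bar>limit_dist m k - limit_dist m k\<bar>)) at_top"
    by (intro tendsto_intros pointwise)
  then have bound: "((\<lambda>t. 2 * (\<Sum>k\<in>S. \<bar>P t k - limit_dist m k\<bar>)) \<longlongrightarrow> 0) at_top" by simp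
  show ?thesis
  proof (rule Lim_null_comparison[OF _ bound])
    have "norm (l1norm (\<lambda>k. P t k - limit_dist m k)) \<le> 2 * (\<Sum>k\<in>S. \<bar>P t k - limit_dist m k\<bar>)"
      if "a \<le> t" for t
    proof -
      note pq = prob[OF that] prob_seq_limit_dist[OF m]
      have "0 \<le> l1norm (\<lambda>k. P t k - limit_dist m k)"
        by (intro l1norm_nonneg summable_on_diff_real prob_seq_summable_on pq)
      with l1norm_diff_le[OF pq, of S] limit_dist_finite_support[OF m] show ?thesis
        by (simp add: S_def)
    qed
    then show "\<forall>\<^sub>F t in at_top. norm (l1norm (\<lambda>k. P t k - limit_dist m k))
        \<le> 2 * (\<Sum>k\<in>S. \<bar>P t k - limit_dist m k\<bar>)"
      by (auto simp: eventually_at_top_linorder)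
  qed
qed

lemma discrete_convergence:
  assumes p: "prob_seq p" and m: "((\<lambda>k. real k * p k) has_sum m) UNIV"
  shows "(\<lambda>n. l1norm (\<lambda>k. (R0 ^^ n) p k - limit_dist m k)) \<longlonglongrightarrow> 0"
proof (rule tendsto_limit_dist[where a = 0])
  show prob: "prob_seq ((R0 ^^ n) p)" for n
    by (induction n) (auto intro: prob_seq_R0 p)
  show "((\<lambda>k. real k * (R0 ^^ n) p k) has_sum m) UNIV" for n
    by (induction n) (auto intro: mean_R0 prob m)
  have step: "trunc_mean c ((R0 ^^ Suc n) p) = trunc_mean c ((R0 ^^ n) p) + gain c ((R0 ^^ n) p)" for c n
    using trunc_mean_R0[OF prob] by simp
  show "trunc_mean c ((R0 ^^ s) p) \<le> trunc_mean c ((R0 ^^ t) p)" if "s \<le> t" for c s t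
    by (rule lift_Suc_mono_le[OF _ that]) (use step gain_nonneg[OF prob] in simp)
  show "\<exists>n\<ge>0. gain c ((R0 ^^ n) p) < \<delta>" if \<delta>: "0 < \<delta>" for c and \<delta> :: real
  proof (rule ccontr)
    assume "\<not> ?thesis"
    then have g: "\<delta> \<le> gain c ((R0 ^^ n) p)" for n by (meson leI zero_le)
    have "real n * \<delta> \<le> trunc_mean c ((R0 ^^ n) p)" for n
    proof (induction n)
      case (Suc n)
      with g[of n] step[of c n] show ?case by (simp add: algebra_simps)
    qed (simp add: trunc_mean_nonneg p)
    moreover obtain n where "real c < real n * \<delta>"
      using reals_Archimedean3[OF \<delta>] by blast
    ultimately show False
      using trunc_mean_le[OF prob, of c n] by (meson less_le_trans not_le)
  qed
qed

section \<open>Differential inequalities\<close>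

lemma continuous_comparison:
  fixes v w :: "real \<Rightarrow> real"
  assumes "0 \<le> T" and cv: "continuous_on {0..T} v" and cw: "continuous_on {0..T} w"
    and init: "w 0 \<le> v 0"
    and step: "\<And>t. 0 \<le> t \<Longrightarrow> t < T \<Longrightarrow> w t = v t \<Longrightarrow> \<forall>\<^sub>F s in at_right t. w s \<le> v s"
  shows "w T \<le> v T"
proof -
  define A where "A = {t \<in> {0..T}. \<forall>s\<in>{0..t}. w s \<le> v s}"
  have A0: "0 \<in> A" using init \<open>0 \<le> T\<close> by (auto simp: A_def)
  have bdd: "bdd_above A" by (auto simp: A_def intro: bdd_aboveI[of _ T])
  define \<tau> where "\<tau> = Sup A"
  have \<tau>: "0 \<le> \<tau>" "\<tau> \<le> T"
  proof -
    show "0 \<le> \<tau>" unfolding \<tau>_def by (rule cSup_upper[OF A0 bdd])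
    show "\<tau> \<le> T" unfolding \<tau>_def using A0 by (intro cSup_least) (auto simp: A_def)
  qed
  have below: "w s \<le> v s" if s: "0 \<le> s" "s < \<tau>" for s
  proof -
    have "A \<noteq> {}" using A0 by auto
    then obtain r where "r \<in> A" "s < r"
      using s(2) less_cSupD[of A s] unfolding \<tau>_def by auto
    with s show ?thesis by (simp add: A_def)
  qed
  have at: "w \<tau> \<le> v \<tau>"
  proof (cases "\<tau> = 0")
    case False
    with \<tau> have pos: "0 < \<tau>" by simp
    have lim: "(f \<longlongrightarrow> f \<tau>) (at_left \<tau>)" if "continuous_on {0..T} f" for f :: "real \<Rightarrow> real"
    proof -
      have "(f \<longlongrightarrow> f \<tau>) (at \<tau> within {0..\<tau>})"
        using that \<tau> by (meson atLeastatMost_subset_iff atLeastAtMost_iff continuous_on_def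
            order_refl tendsto_within_subset)
      then show ?thesis
        using pos by (simp add: at_within_Icc_at_left)
    qed
    show ?thesis
    proof (rule tendsto_le[OF _ lim[OF cv] lim[OF cw]])
      show "\<forall>\<^sub>F s in at_left \<tau>. w s \<le> v s"
        using eventually_at_left_real[OF pos] by eventually_elim (auto intro: below)
    qed simp
  qed (use init in simp)
  show ?thesis
  proof (rule ccontr)
    assume "\<not> w T \<le> v T"
    with at \<tau> have lt: "\<tau> < T" by (cases "\<tau> = T") auto
    have "\<forall>\<^sub>F s in at_right \<tau>. w s \<le> v s"
    proof (cases "w \<tau> = v \<tau>")
      case False
      with at have "w \<tau> < v \<tau>" by simp
      have "((\<lambda>s. v s - w s) \<longlongrightarrow> v \<tau> - w \<tau>) (at \<tau> within {0..T})"
        using cv cw \<tau> by (intro tendsto_diff) (auto simp: continuous_on_def)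
      then have "((\<lambda>s. v s - w s) \<longlongrightarrow> v \<tau> - w \<tau>) (at \<tau> within {\<tau>..T})"
        by (rule tendsto_within_subset) (use \<tau> in auto)
      then have "((\<lambda>s. v s - w s) \<longlongrightarrow> v \<tau> - w \<tau>) (at_right \<tau>)"
        using lt by (simp add: at_within_Icc_at_right)
      then have "\<forall>\<^sub>F s in at_right \<tau>. 0 < v s - w s"
        by (rule order_tendstoD) (use \<open>w \<tau> < v \<tau>\<close> in simp)
      then show ?thesis by eventually_elim simp
    qed (use step \<tau> lt in auto)
    then obtain b where b: "\<tau> < b" "\<And>s. \<tau> < s \<Longrightarrow> s < b \<Longrightarrow> w s \<le> v s"
      by (auto simp: eventually_at_right_field)
    define r where "r = (\<tau> + min b T) / 2"
    have r: "\<tau> < r" "r < b" "r \<le> T" using b lt by (auto simp: r_def min_def)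
    have "r \<in> A"
      unfolding A_def
    proof (intro CollectI conjI ballI)
      fix s assume "s \<in> {0..r}"
      then show "w s \<le> v s" using r below at b(2) by (cases s \<tau> rule: linorder_cases) auto
    qed (use r \<tau> in auto)
    then have "r \<le> \<tau>" unfolding \<tau>_def using bdd by (rule cSup_upper)
    with r show False by simp
  qed
qed

text \<open>A one-sided hypothesis is needed because the negative part of a solution is not
  differentiable in time.\<close>
lemma dini_gronwall:
  fixes w :: "real \<Rightarrow> real"
  assumes T: "0 \<le> T" and cont: "continuous_on {0..T} w"
    and dini: "\<And>t \<epsilon>. 0 \<le> t \<Longrightarrow> t < T \<Longrightarrow> 0 < \<epsilon> \<Longrightarrow>
      \<forall>\<^sub>F s in at_right t. w s \<le> w t + (s - t) * (C * w t + \<epsilon>)"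
  shows "w T \<le> w 0 * exp (C * T)"
proof -
  have approx: "w T \<le> w 0 * exp (C * T) + \<eta> * exp ((C + 1) * T)" if \<eta>: "0 < \<eta>" for \<eta>
  proof -
    define v where "v t = w 0 * exp (C * t) + \<eta> * exp ((C + 1) * t)" for t
    have dv: "(v has_real_derivative C * v t + \<eta> * exp ((C + 1) * t)) (at t)" for t
      unfolding v_def by (auto intro!: derivative_eq_intros simp: algebra_simps)
    have "w T \<le> v T"
    proof (rule continuous_comparison[OF T _ cont])
      show "continuous_on {0..T} v"
        by (meson DERIV_continuous_on dv has_field_derivative_at_within)
      show "w 0 \<le> v 0" using \<eta> by (simp add: v_def)
      fix t assume t: "0 \<le> t" "t < T" "w t = v t"
      define \<epsilon> where "\<epsilon> = \<eta> * exp ((C + 1) * t) / 2"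
      have \<epsilon>: "0 < \<epsilon>" using \<eta> by (simp add: \<epsilon>_def)
      have "((\<lambda>s. (v s - v t) / (s - t)) \<longlongrightarrow> C * v t + \<eta> * exp ((C + 1) * t)) (at_right t)"
        using has_field_derivative_at_within[OF dv] by (simp add: has_field_derivative_iff)
      then have "\<forall>\<^sub>F s in at_right t. C * v t + \<epsilon> < (v s - v t) / (s - t)"
        by (rule order_tendstoD) (use \<epsilon> in \<open>simp add: \<epsilon>_def\<close>)
      moreover have "\<forall>\<^sub>F s in at_right t. t < s"
        by (simp add: eventually_at_right_less)
      ultimately show "\<forall>\<^sub>F s in at_right t. w s \<le> v s"
        using dini[OF t(1,2) \<epsilon>]
      proof eventually_elim
        case (elim s)
        then have "(C * v t + \<epsilon>) * (s - t) < v s - v t" by (simp add: pos_less_divide_eq)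
        with elim t(3) show ?case by (simp add: mult.commute)
      qed
    qed
    then show ?thesis by (simp add: v_def)
  qed
  show ?thesis
  proof (rule field_le_epsilon)
    fix e :: real assume "0 < e"
    then show "w T \<le> w 0 * exp (C * T) + e"
      using approx[of "e / exp ((C + 1) * T)"] by simp
  qed
qed

lemma gronwall:
  fixes w :: "real \<Rightarrow> real"
  assumes "0 \<le> T"
    and deriv: "\<And>t. 0 \<le> t \<Longrightarrow> t \<le> T \<Longrightarrow> (w has_real_derivative w' t) (at t within {0..})"
    and le: "\<And>t. 0 \<le> t \<Longrightarrow> t \<le> T \<Longrightarrow> w' t \<le> C * w t"
  shows "w T \<le> w 0 * exp (C * T)"
proof (rule dini_gronwall[OF \<open>0 \<le> T\<close>])
  show "continuous_on {0..T} w"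
    by (rule DERIV_continuous_on) (auto intro: has_field_derivative_subset[OF deriv])
  fix t \<epsilon> :: real assume t: "0 \<le> t" "t < T" "0 < \<epsilon>"
  have "((\<lambda>s. (w s - w t) / (s - t)) \<longlongrightarrow> w' t) (at t within {0..})"
    using deriv[of t] t by (simp add: has_field_derivative_iff)
  then have "((\<lambda>s. (w s - w t) / (s - t)) \<longlongrightarrow> w' t) (at_right t)"
    by (rule tendsto_within_subset) (use t in auto)
  then have "\<forall>\<^sub>F s in at_right t. (w s - w t) / (s - t) < C * w t + \<epsilon>"
    by (rule order_tendstoD) (use le[of t] t in simp)
  moreover have "\<forall>\<^sub>F s in at_right t. t < s"
    by (simp add: eventually_at_right_less)
  ultimately show "\<forall>\<^sub>F s in at_right t. w s \<le> w t + (s - t) * (C * w t + \<epsilon>)"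
  proof eventually_elim
    case (elim s)
    then have "w s - w t < (C * w t + \<epsilon>) * (s - t)" by (simp add: pos_divide_less_eq)
    then show ?case by (simp add: mult.commute)
  qed
qed

lemma has_derivative_mvt:
  fixes f :: "real \<Rightarrow> real"
  assumes "0 \<le> a" "a < b" and "\<And>t. 0 \<le> t \<Longrightarrow> (f has_real_derivative f' t) (at t within {0..})"
  obtains x where "a < x" "x < b" "f b - f a = f' x * (b - a)"
proof -
  have "\<exists>x\<in>{a<..<b}. f b - f a = f' x * (b - a)"
  proof (rule mvt_simple[OF \<open>a < b\<close>])
    fix t assume t: "a \<le> t" "t \<le> b"
    with \<open>0 \<le> a\<close> have "0 \<le> t" by simp
    from has_field_derivative_subset[OF assms(3)[OF this], of "{a..b}"] \<open>0 \<le> a\<close>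
    show "(f has_derivative (*) (f' t)) (at t within {a..b})"
      by (auto simp: has_field_derivative_def)
  qed
  then show ?thesis using that by auto
qed

lemma abs_bounded_functional_le:
  assumes "x summable_on UNIV" and f: "\<And>k. \<bar>f k\<bar> \<le> C"
  shows "\<bar>\<Sum>\<^sub>\<infinity>k. f k * x k\<bar> \<le> C * l1norm x"
proof -
  note a = summable_on_abs_real[OF assms(1)]
  have "norm (\<Sum>\<^sub>\<infinity>k. f k * x k) \<le> C * (\<Sum>\<^sub>\<infinity>k. \<bar>x k\<bar>)"
  proof (rule norm_infsum_le)
    show "((\<lambda>k. f k * x k) has_sum (\<Sum>\<^sub>\<infinity>k. f k * x k)) UNIV"
      using summable_on_bounded_mult[OF assms(1), of f C] f by simp
    show "((\<lambda>k. C * \<bar>x k\<bar>) has_sum C * (\<Sum>\<^sub>\<infinity>k. \<bar>x k\<bar>)) UNIV"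
      using a by (intro has_sum_cmult_right) simp
    show "norm (f k * x k) \<le> C * \<bar>x k\<bar>" for k
      using f by (auto simp: abs_mult intro: mult_right_mono)
  qed
  then show ?thesis by (simp add: l1norm_eq_infsum[OF assms(1)])
qed

definition neg_mass :: "(nat \<Rightarrow> real) \<Rightarrow> real" where
  "neg_mass x = (\<Sum>\<^sub>\<infinity>k. max 0 (- x k))"

lemma neg_mass_has_sum:
  assumes "x summable_on UNIV"
  shows "((\<lambda>k. max 0 (- x k)) has_sum neg_mass x) UNIV"
  unfolding neg_mass_def
  by (rule has_sum_infsum, rule summable_on_comparison_test[OF summable_on_abs_real[OF assms]]) auto

lemma neg_mass_nonneg: "0 \<le> neg_mass x"
  unfolding neg_mass_def by (rule infsum_nonneg) simp

lemma abs_has_sum_l1norm: "x summable_on UNIV \<Longrightarrow> ((\<lambda>k. \<bar>x k\<bar>) has_sum l1norm x) UNIV"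
  by (simp add: l1norm_eq_infsum summable_on_abs_real)

lemma neg_mass_R0_le:
  assumes "p summable_on UNIV"
  shows "neg_mass (R0 p) \<le> 2 * l1norm p * neg_mass p"
proof -
  define x where "x = (\<lambda>(k, l). p k * p l)"
  define y where "y = (\<lambda>(k, l). \<bar>p k\<bar> * max 0 (- p l) + max 0 (- p k) * \<bar>p l\<bar>)"
  note a = abs_has_sum_l1norm[OF assms] and n = neg_mass_has_sum[OF assms]
  have y: "(y has_sum l1norm p * neg_mass p + neg_mass p * l1norm p) UNIV"
    using has_sum_add[OF has_sum_product_real[OF a n] has_sum_product_real[OF n a]]
    by (simp add: y_def case_prod_unfold)
  have sx: "(\<lambda>z. - x z) summable_on UNIV"
    unfolding summable_on_uminus x_def by (rule summable_on_pairs[OF assms])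
  have sy: "y summable_on UNIV" using y by (rule has_sum_imp_summable)
  have ypos: "0 \<le> y z" for z by (auto simp: y_def split: prod.split)
  have "- x z \<le> y z" for z
  proof -
    obtain k l where z: "z = (k, l)" by fastforce
    consider "0 \<le> p k" "0 \<le> p l" | "0 \<le> p k" "p l \<le> 0" | "p k \<le> 0" "0 \<le> p l" | "p k \<le> 0" "p l \<le> 0"
      by linarith
    then show ?thesis
    proof cases
      case 4
      then have "0 \<le> p k * p l" by (rule mult_nonpos_nonpos)
      with ypos[of z] show ?thesis by (simp add: x_def z)
    qed (auto simp: x_def y_def z)
  qed
  then have "recombine (\<lambda>z. - x z) i \<le> recombine y i" for i
    by (rule recombine_mono[OF sx sy])
  then have "- R0 p i \<le> recombine y i" for i
    by (simp add: R0_eq_recombine x_def[symmetric] recombine_def infsum_uminus)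
  moreover have "0 \<le> recombine y i" for i
    unfolding recombine_def by (rule infsum_nonneg) (simp add: ypos crossover_kernel_nonneg)
  ultimately have le: "max 0 (- R0 p i) \<le> recombine y i" for i by simp
  have "(recombine y has_sum infsum y UNIV) UNIV"
    using recombine_has_sum[OF sy, of "\<lambda>_. 1" 1] by (simp add: interval_mean_const)
  then have "neg_mass (R0 p) \<le> infsum y UNIV"
    by (rule has_sum_mono[OF neg_mass_has_sum[OF R0_summable_on[OF assms]]]) (rule le)
  with infsumI[OF y] show ?thesis by (simp add: mult_ac)
qed

section \<open>Solutions of the differential equation\<close>

locale l1_solution =
  fixes p :: "real \<Rightarrow> nat \<Rightarrow> real"
  assumes summ: "0 \<le> t \<Longrightarrow> p t summable_on UNIV"
    and deriv: "0 \<le> t \<Longrightarrow> has_l1_derivative p (\<lambda>k. R0 (p t) k - p t k) t"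
    and init: "prob_seq (p 0)"
begin

definition remainder :: "real \<Rightarrow> real \<Rightarrow> nat \<Rightarrow> real" where
  "remainder t s k = (p s k - p t k) / (s - t) - (R0 (p t) k - p t k)"

lemma velocity_summable: "0 \<le> t \<Longrightarrow> (\<lambda>k. R0 (p t) k - p t k) summable_on UNIV"
  by (intro summable_on_diff_real R0_summable_on summ)

lemma quotient_summable: "0 \<le> t \<Longrightarrow> 0 \<le> s \<Longrightarrow> (\<lambda>k. (p s k - p t k) / (s - t)) summable_on UNIV"
  using summable_on_cmult_left[OF summable_on_diff_real[OF summ summ], of s t "1 / (s - t)"] by simp

lemma remainder_summable: "0 \<le> t \<Longrightarrow> 0 \<le> s \<Longrightarrow> remainder t s summable_on UNIV"
  unfolding remainder_def[abs_def] by (intro summable_on_diff_real[OF quotient_summable velocity_summable])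

lemma remainder_tendsto: "0 \<le> t \<Longrightarrow> ((\<lambda>s. l1norm (remainder t s)) \<longlongrightarrow> 0) (at t within {0..})"
  using deriv[of t] by (simp add: has_l1_derivative_def remainder_def[abs_def])

lemma functional_has_derivative:
  assumes t: "0 \<le> t" and f: "\<And>k. \<bar>f k\<bar> \<le> C"
  shows "((\<lambda>s. \<Sum>\<^sub>\<infinity>k. f k * p s k) has_real_derivative
    (\<Sum>\<^sub>\<infinity>k. f k * R0 (p t) k) - (\<Sum>\<^sub>\<infinity>k. f k * p t k)) (at t within {0..})"
proof -
  note fs = summable_on_bounded_mult[where f = f and C = C, OF _ f]
  have "((\<lambda>s. (\<Sum>\<^sub>\<infinity>k. f k * remainder t s k)) \<longlongrightarrow> 0) (at t within {0..})"
  proof (rule Lim_null_comparison)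
    show "((\<lambda>s. C * l1norm (remainder t s)) \<longlongrightarrow> 0) (at t within {0..})"
      using tendsto_mult_left[OF remainder_tendsto[OF t], of C] by simp
    show "\<forall>\<^sub>F s in at t within {0..}. norm (\<Sum>\<^sub>\<infinity>k. f k * remainder t s k) \<le> C * l1norm (remainder t s)"
      unfolding eventually_at_filter
      by (auto intro!: always_eventually abs_bounded_functional_le remainder_summable t f)
  qed
  moreover have "\<forall>\<^sub>F s in at t within {0..}. (\<Sum>\<^sub>\<infinity>k. f k * remainder t s k) =
      ((\<Sum>\<^sub>\<infinity>k. f k * p s k) - (\<Sum>\<^sub>\<infinity>k. f k * p t k)) / (s - t)
        - ((\<Sum>\<^sub>\<infinity>k. f k * R0 (p t) k) - (\<Sum>\<^sub>\<infinity>k. f k * p t k))"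
    unfolding eventually_at_filter
  proof (intro always_eventually allI impI)
    fix s assume "s \<noteq> t" "s \<in> {0..}"
    then have s: "0 \<le> s" by simp
    have "f k * remainder t s k = (f k * p s k - f k * p t k) * (1 / (s - t))
        - (f k * R0 (p t) k - f k * p t k)" for k
      by (simp add: remainder_def algebra_simps diff_divide_distrib)
    then have "(\<Sum>\<^sub>\<infinity>k. f k * remainder t s k) = (\<Sum>\<^sub>\<infinity>k. (f k * p s k - f k * p t k) * (1 / (s - t)))
        - (\<Sum>\<^sub>\<infinity>k. f k * R0 (p t) k - f k * p t k)"
      by (simp only:) (intro infsum_diff_real summable_on_cmult_left summable_on_diff_real fs
          summ R0_summable_on s t)
    also have "(\<Sum>\<^sub>\<infinity>k. f k * R0 (p t) k - f k * p t k) = (\<Sum>\<^sub>\<infinity>k. f k * R0 (p t) k) - (\<Sum>\<^sub>\<infinity>k. f k * p t k)"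
      by (intro infsum_diff_real fs summ R0_summable_on t)
    also have "(\<Sum>\<^sub>\<infinity>k. (f k * p s k - f k * p t k) * (1 / (s - t))) =
        ((\<Sum>\<^sub>\<infinity>k. f k * p s k) - (\<Sum>\<^sub>\<infinity>k. f k * p t k)) * (1 / (s - t))"
      unfolding infsum_cmult_left'
      by (subst infsum_diff_real) (auto intro!: fs summ s t)
    finally show "(\<Sum>\<^sub>\<infinity>k. f k * remainder t s k) =
      ((\<Sum>\<^sub>\<infinity>k. f k * p s k) - (\<Sum>\<^sub>\<infinity>k. f k * p t k)) / (s - t)
        - ((\<Sum>\<^sub>\<infinity>k. f k * R0 (p t) k) - (\<Sum>\<^sub>\<infinity>k. f k * p t k))" by simp
  qed
  ultimately have "((\<lambda>s. ((\<Sum>\<^sub>\<infinity>k. f k * p s k) - (\<Sum>\<^sub>\<infinity>k. f k * p t k)) / (s - t)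
        - ((\<Sum>\<^sub>\<infinity>k. f k * R0 (p t) k) - (\<Sum>\<^sub>\<infinity>k. f k * p t k))) \<longlongrightarrow> 0) (at t within {0..})"
    by (rule Lim_transform_eventually)
  then show ?thesis
    unfolding has_field_derivative_iff by (rule LIM_zero_cancel)
qed

lemma l1_continuous:
  assumes t: "0 \<le> t"
  shows "((\<lambda>s. l1norm (\<lambda>k. p s k - p t k)) \<longlongrightarrow> 0) (at t within {0..})"
proof (rule Lim_null_comparison)
  let ?D = "\<lambda>k. R0 (p t) k - p t k"
  have "((\<lambda>s. \<bar>s - t\<bar> * (l1norm (remainder t s) + l1norm ?D)) \<longlongrightarrow> \<bar>t - t\<bar> * (0 + l1norm ?D))
      (at t within {0..})"
    by (intro tendsto_intros remainder_tendsto t)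
  then show "((\<lambda>s. \<bar>s - t\<bar> * (l1norm (remainder t s) + l1norm ?D)) \<longlongrightarrow> 0) (at t within {0..})" by simp
  show "\<forall>\<^sub>F s in at t within {0..}. norm (l1norm (\<lambda>k. p s k - p t k))
      \<le> \<bar>s - t\<bar> * (l1norm (remainder t s) + l1norm ?D)"
    unfolding eventually_at_filter
  proof (intro always_eventually allI impI)
    fix s assume ne: "s \<noteq> t" and "s \<in> {0..}"
    then have s: "0 \<le> s" by simp
    have "\<bar>p s k - p t k\<bar> \<le> \<bar>s - t\<bar> * (\<bar>remainder t s k\<bar> + \<bar>?D k\<bar>)" for k
    proof -
      have "p s k - p t k = (s - t) * (remainder t s k + ?D k)"
        using ne by (simp add: remainder_def)
      then show ?thesis
        by (simp only: abs_mult) (intro mult_left_mono abs_triangle_ineq abs_ge_zero)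
    qed
    moreover note d = summable_on_diff_real[OF summ[OF s] summ[OF t]]
    moreover have "((\<lambda>k. \<bar>s - t\<bar> * (\<bar>remainder t s k\<bar> + \<bar>?D k\<bar>)) has_sum
        \<bar>s - t\<bar> * (l1norm (remainder t s) + l1norm ?D)) UNIV"
      by (intro has_sum_cmult_right has_sum_add abs_has_sum_l1norm remainder_summable velocity_summable s t)
    ultimately have "l1norm (\<lambda>k. p s k - p t k) \<le> \<bar>s - t\<bar> * (l1norm (remainder t s) + l1norm ?D)"
      by (intro has_sum_mono[OF abs_has_sum_l1norm]) auto
    with l1norm_nonneg[OF d] show "norm (l1norm (\<lambda>k. p s k - p t k))
        \<le> \<bar>s - t\<bar> * (l1norm (remainder t s) + l1norm ?D)" by simp
  qed
qed

lemma continuous_of_nonexpansive: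
  assumes "\<And>x y. x summable_on UNIV \<Longrightarrow> y summable_on UNIV \<Longrightarrow> \<Phi> x \<le> \<Phi> y + l1norm (\<lambda>k. x k - y k)"
  shows "continuous_on {0..} (\<lambda>t. \<Phi> (p t) :: real)"
  unfolding continuous_on_def
proof
  fix t :: real assume "t \<in> {0..}"
  then have t: "0 \<le> t" by simp
  have "((\<lambda>s. \<Phi> (p s) - \<Phi> (p t)) \<longlongrightarrow> 0) (at t within {0..})"
  proof (rule Lim_null_comparison[OF _ l1_continuous[OF t]])
    have "norm (\<Phi> (p s) - \<Phi> (p t)) \<le> l1norm (\<lambda>k. p s k - p t k)" if "0 \<le> s" for s
    proof -
      have "l1norm (\<lambda>k. p t k - p s k) = l1norm (\<lambda>k. p s k - p t k)"
        by (simp add: l1norm_def abs_minus_commute)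
      then show ?thesis
        using assms[OF summ summ, OF t that] assms[OF summ summ, OF that t] by simp
    qed
    then show "\<forall>\<^sub>F s in at t within {0..}. norm (\<Phi> (p s) - \<Phi> (p t)) \<le> l1norm (\<lambda>k. p s k - p t k)"
      unfolding eventually_at_filter by (auto intro: always_eventually)
  qed
  then show "((\<lambda>t. \<Phi> (p t)) \<longlongrightarrow> \<Phi> (p t)) (at t within {0..})"
    by (rule LIM_zero_cancel)
qed

lemma norm_bounded:
  obtains C where "0 \<le> C" "\<And>t. 0 \<le> t \<Longrightarrow> t \<le> T \<Longrightarrow> l1norm (p t) \<le> C"
proof -
  have "continuous_on {0..} (\<lambda>t. l1norm (p t))"
  proof (rule continuous_of_nonexpansive)
    fix x y :: "nat \<Rightarrow> real" assume xy: "x summable_on UNIV" "y summable_on UNIV"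
    show "l1norm x \<le> l1norm y + l1norm (\<lambda>k. x k - y k)"
      by (rule has_sum_mono[OF abs_has_sum_l1norm has_sum_add[OF abs_has_sum_l1norm abs_has_sum_l1norm]])
         (auto intro: xy summable_on_diff_real)
  qed
  then have "compact ((\<lambda>t. l1norm (p t)) ` {0..T})"
    by (intro compact_continuous_image) (auto intro: continuous_on_subset)
  then have "bdd_above ((\<lambda>t. l1norm (p t)) ` {0..T})"
    by (intro bounded_imp_bdd_above compact_imp_bounded)
  then obtain C where "\<And>t. t \<in> {0..T} \<Longrightarrow> l1norm (p t) \<le> C"
    unfolding bdd_above_def by blast
  then show ?thesis
    by (intro that[of "max C 0"]) (auto intro: max.coboundedI1)
qed

lemma mass_one:
  assumes T: "0 \<le> T"
  shows "(\<Sum>\<^sub>\<infinity>k. p T k) = 1"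
proof -
  define u where "u t = (\<Sum>\<^sub>\<infinity>k. p t k) - 1" for t
  obtain C where C: "\<And>t. 0 \<le> t \<Longrightarrow> t \<le> T \<Longrightarrow> l1norm (p t) \<le> C" using norm_bounded by metis
  have du: "(u has_real_derivative (u t + 1) * u t) (at t within {0..})" if "0 \<le> t" for t
  proof -
    have "(\<Sum>\<^sub>\<infinity>k. R0 (p t) k) = (u t + 1) * (u t + 1)"
      using R0_has_sum_mass[OF has_sum_infsum[OF summ[OF that]]] by (simp add: u_def infsumI)
    then have "((\<lambda>s. u s + 1) has_real_derivative (u t + 1) * u t) (at t within {0..})"
      using functional_has_derivative[OF that, of "\<lambda>_. 1" 1] by (simp add: u_def algebra_simps)
    from DERIV_diff[OF this DERIV_const[of 1]] show ?thesis by simp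
  qed
  have "(u T)\<^sup>2 \<le> (u 0)\<^sup>2 * exp (2 * C * T)"
  proof (rule gronwall[OF T, where w' = "\<lambda>t. 2 * (u t + 1) * (u t)\<^sup>2"])
    fix t assume t: "0 \<le> t" "t \<le> T"
    show "((\<lambda>t. (u t)\<^sup>2) has_real_derivative 2 * (u t + 1) * (u t)\<^sup>2) (at t within {0..})"
      by (auto intro!: derivative_eq_intros du t simp: power2_eq_square algebra_simps)
    have "u t + 1 \<le> C"
      using abs_bounded_functional_le[OF summ[OF t(1)], of "\<lambda>_. 1" 1] C[OF t] by (simp add: u_def)
    then show "2 * (u t + 1) * (u t)\<^sup>2 \<le> 2 * C * (u t)\<^sup>2"
      by (intro mult_right_mono) auto
  qed
  moreover have "u 0 = 0"
    using init by (simp add: u_def prob_seq_iff_has_sum infsumI)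
  ultimately show ?thesis by (simp add: u_def)
qed

lemma neg_mass_zero:
  assumes T: "0 \<le> T"
  shows "neg_mass (p T) = 0"
proof -
  obtain C where C: "0 \<le> C" "\<And>t. 0 \<le> t \<Longrightarrow> t \<le> T \<Longrightarrow> l1norm (p t) \<le> C" using norm_bounded by metis
  have "neg_mass (p T) \<le> neg_mass (p 0) * exp ((2 * C) * T)"
  proof (rule dini_gronwall[OF T])
    have "continuous_on {0..} (\<lambda>t. neg_mass (p t))"
    proof (rule continuous_of_nonexpansive)
      fix x y :: "nat \<Rightarrow> real" assume xy: "x summable_on UNIV" "y summable_on UNIV"
      show "neg_mass x \<le> neg_mass y + l1norm (\<lambda>k. x k - y k)"
        by (rule has_sum_mono[OF neg_mass_has_sum has_sum_add[OF neg_mass_has_sum abs_has_sum_l1norm]])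
           (auto intro: xy summable_on_diff_real)
    qed
    then show "continuous_on {0..T} (\<lambda>t. neg_mass (p t))"
      by (rule continuous_on_subset) auto
  next
    fix t \<epsilon> :: real assume t: "0 \<le> t" "t < T" "0 < \<epsilon>"
    have "((\<lambda>s. l1norm (remainder t s)) \<longlongrightarrow> 0) (at_right t)"
      by (rule tendsto_within_subset[OF remainder_tendsto[OF t(1)]]) (use t in auto)
    then have "\<forall>\<^sub>F s in at_right t. l1norm (remainder t s) < \<epsilon>"
      by (rule order_tendstoD) (use t in simp)
    moreover have "\<forall>\<^sub>F s in at_right t. s \<in> {t<..<t + 1}"
      by (rule eventually_at_right_real) simp
    ultimately show "\<forall>\<^sub>F s in at_right t. neg_mass (p s)
        \<le> neg_mass (p t) + (s - t) * (2 * C * neg_mass (p t) + \<epsilon>)"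
    proof eventually_elim
      case (elim s)
      define h where "h = s - t"
      have h: "0 < h" "h \<le> 1" and s: "0 \<le> s" using elim t by (auto simp: h_def)
      have "neg_mass (p s) \<le> (1 - h) * neg_mass (p t) + (h * neg_mass (R0 (p t)) + h * l1norm (remainder t s))"
      proof (rule has_sum_mono[OF neg_mass_has_sum[OF summ[OF s]]])
        show "((\<lambda>k. (1 - h) * max 0 (- p t k) + (h * max 0 (- R0 (p t) k) + h * \<bar>remainder t s k\<bar>)) has_sum
          (1 - h) * neg_mass (p t) + (h * neg_mass (R0 (p t)) + h * l1norm (remainder t s))) UNIV"
          by (intro has_sum_add has_sum_cmult_right neg_mass_has_sum abs_has_sum_l1norm
              summ R0_summable_on remainder_summable t s)
        fix k
        have "- p s k = (1 - h) * (- p t k) + (h * (- R0 (p t) k) + h * (- remainder t s k))"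
          using h(1) by (simp add: remainder_def h_def[symmetric] field_simps)
        also have "\<dots> \<le> (1 - h) * max 0 (- p t k) + (h * max 0 (- R0 (p t) k) + h * \<bar>remainder t s k\<bar>)"
          using h by (intro add_mono mult_left_mono) auto
        finally show "max 0 (- p s k)
            \<le> (1 - h) * max 0 (- p t k) + (h * max 0 (- R0 (p t) k) + h * \<bar>remainder t s k\<bar>)"
          using h by simp
      qed
      also have "\<dots> \<le> 1 * neg_mass (p t) + (h * (2 * C * neg_mass (p t)) + h * \<epsilon>)"
      proof (intro add_mono mult_right_mono mult_left_mono)
        have "2 * l1norm (p t) * neg_mass (p t) \<le> 2 * C * neg_mass (p t)"
          using C t by (intro mult_right_mono neg_mass_nonneg) auto
        with neg_mass_R0_le[OF summ[OF t(1)]]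
        show "neg_mass (R0 (p t)) \<le> 2 * C * neg_mass (p t)" by linarith
      qed (use h elim neg_mass_nonneg in auto)
      finally show ?case by (simp add: h_def distrib_left)
    qed
  qed
  moreover have "neg_mass (p 0) = 0"
    unfolding neg_mass_def by (rule infsum_0) (simp add: prob_seq_nonneg[OF init])
  ultimately show ?thesis using neg_mass_nonneg[of "p T"] by simp
qed

lemma prob:
  assumes "0 \<le> t"
  shows "prob_seq (p t)"
  unfolding prob_seq_iff_has_sum
proof (intro conjI allI)
  show "(p t has_sum 1) UNIV"
    using summ[OF assms] mass_one[OF assms] by (simp add: has_sum_iff)
  fix k
  have "max 0 (- p t k) = 0"
    using neg_mass_has_sum[OF summ[OF assms]] neg_mass_zero[OF assms]
    by (intro nonneg_has_sum_le_0D[where f = "\<lambda>k. max 0 (- p t k)" and A = UNIV and a = 0]) auto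
  then show "0 \<le> p t k" by (simp add: max_def split: if_splits)
qed

lemma trunc_mean_has_derivative:
  assumes "0 \<le> t"
  shows "((\<lambda>s. trunc_mean c (p s)) has_real_derivative gain c (p t)) (at t within {0..})"
  using functional_has_derivative[OF assms, of "\<lambda>k. real (min k c)" "real c"]
    trunc_mean_R0[OF prob[OF assms], of c]
  by (simp add: trunc_mean_def)

lemma trunc_mean_mono_time:
  assumes "0 \<le> s" "s \<le> t"
  shows "trunc_mean c (p s) \<le> trunc_mean c (p t)"
proof (cases "s = t")
  case False
  with assms have "s < t" by simp
  then obtain x where x: "s < x" "trunc_mean c (p t) - trunc_mean c (p s) = gain c (p x) * (t - s)"
    by (rule has_derivative_mvt[OF assms(1) _ trunc_mean_has_derivative])
  moreover have "0 \<le> gain c (p x) * (t - s)"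
    using assms x by (intro mult_nonneg_nonneg gain_nonneg prob) auto
  ultimately show ?thesis by simp
qed simp

text \<open>The first moment is not a continuous functional on the sequence space, so it cannot be
  differentiated along the solution. Instead, the bounds \<open>(trunc_mean c)' \<le> trunc_mean (2c) - trunc_mean c\<close>
  telescope along \<open>c, 2c, 4c, \<dots>\<close>: any excess over \<open>m\<close> would be counted arbitrarily often,
  while the sum stays bounded.\<close>
lemma trunc_mean_le_initial_mean:
  assumes m: "((\<lambda>k. real k * p 0 k) has_sum m) UNIV" and T: "0 \<le> T"
  shows "trunc_mean c (p T) \<le> m"
proof (rule ccontr)
  assume "\<not> ?thesis"
  then have gt: "0 < trunc_mean c (p T) - m" by simp
  have init_le: "trunc_mean d (p 0) \<le> m" for d
    by (rule trunc_mean_le_mean[OF init m])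
  have m0: "0 \<le> m" using init_le[of 0] trunc_mean_nonneg[OF init, of 0] by linarith
  have Tpos: "0 < T" using gt init_le[of c] T by (cases "T = 0") auto
  define B where "B = m * exp T"
  have bound: "trunc_mean d (p t) \<le> B" if t: "0 \<le> t" "t \<le> T" for d t
  proof -
    have "trunc_mean d (p t) \<le> trunc_mean d (p 0) * exp (1 * t)"
    proof (rule gronwall[OF t(1), where w' = "\<lambda>t. gain d (p t)"])
      fix s :: real assume s: "0 \<le> s"
      show "((\<lambda>t. trunc_mean d (p t)) has_real_derivative gain d (p s)) (at s within {0..})"
        by (rule trunc_mean_has_derivative[OF s])
      show "gain d (p s) \<le> 1 * trunc_mean d (p s)"
        using gain_le[OF prob[OF s], of d] trunc_mean_double_le[OF prob[OF s], of d] by simp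
    qed
    also have "\<dots> \<le> m * exp T"
      using init_le m0 t by (intro mult_mono) auto
    finally show ?thesis by (simp add: B_def)
  qed
  define S where "S J t = (\<Sum>j<J. trunc_mean (2 ^ j * c) (p t))" for J :: nat and t
  have "real J * (trunc_mean c (p T) - m) \<le> B * T" for J
  proof -
    obtain x where x: "0 < x" "x < T" "S J T - S J 0 = (\<Sum>j<J. gain (2 ^ j * c) (p x)) * (T - 0)"
    proof (rule has_derivative_mvt[of 0 T "S J" "\<lambda>t. \<Sum>j<J. gain (2 ^ j * c) (p t)"])
      show "(S J has_real_derivative (\<Sum>j<J. gain (2 ^ j * c) (p t))) (at t within {0..})" if "0 \<le> t" for t
        unfolding S_def[abs_def] by (intro DERIV_sum trunc_mean_has_derivative that)
    qed (use Tpos in auto)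
    have px: "prob_seq (p x)" using x by (intro prob) simp
    have "(\<Sum>j<J. gain (2 ^ j * c) (p x))
        \<le> (\<Sum>j<J. trunc_mean (2 ^ Suc j * c) (p x) - trunc_mean (2 ^ j * c) (p x))"
      using gain_le[OF px] by (intro sum_mono) (simp add: mult.assoc)
    also have "\<dots> = trunc_mean (2 ^ J * c) (p x) - trunc_mean c (p x)"
      by (subst sum_lessThan_telescope[of "\<lambda>j. trunc_mean (2 ^ j * c) (p x)"]) simp
    also have "\<dots> \<le> B"
      using bound[of x "2 ^ J * c"] trunc_mean_nonneg[OF px, of c] x by simp
    finally have "S J T - S J 0 \<le> B * T"
      using x Tpos by (simp add: mult_right_mono)
    moreover have "(\<Sum>j<J. trunc_mean c (p T) - m) \<le> S J T - S J 0"
      unfolding S_def sum_subtractf[symmetric]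
    proof (intro sum_mono diff_mono init_le)
      show "trunc_mean c (p T) \<le> trunc_mean (2 ^ j * c) (p T)" for j
        by (rule trunc_mean_mono[OF prob[OF T]]) simp
    qed
    ultimately show ?thesis by simp
  qed
  moreover obtain J where "B * T < real J * (trunc_mean c (p T) - m)"
    using reals_Archimedean3[OF gt] by blast
  ultimately show False by (meson not_le)
qed

lemma mean_conserved:
  assumes m: "((\<lambda>k. real k * p 0 k) has_sum m) UNIV" and t: "0 \<le> t"
  shows "((\<lambda>k. real k * p t k) has_sum m) UNIV"
proof (rule mean_has_sum_of_trunc_mean[OF prob[OF t]])
  show "(\<lambda>c. trunc_mean c (p t)) \<longlonglongrightarrow> m"
    by (rule tendsto_sandwich[OF always_eventually always_eventually
          trunc_mean_tendsto_mean[OF init m] tendsto_const])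
       (use trunc_mean_mono_time[OF order_refl t] trunc_mean_le_initial_mean[OF m t] in auto)
qed

lemma convergence:
  assumes m: "((\<lambda>k. real k * p 0 k) has_sum m) UNIV"
  shows "((\<lambda>t. l1norm (\<lambda>k. p t k - limit_dist m k)) \<longlongrightarrow> 0) at_top"
proof (rule tendsto_limit_dist[where a = 0])
  show "\<exists>t\<ge>0. gain c (p t) < \<delta>" if \<delta>: "0 < \<delta>" for c \<delta>
  proof (rule ccontr)
    assume "\<not> ?thesis"
    then have g: "\<delta> \<le> gain c (p t)" if "0 \<le> t" for t using that by (meson leI)
    define b where "b = (real c + 1) / \<delta>"
    have b: "0 < b" using \<delta> by (simp add: b_def)
    obtain x where x: "0 < x" "trunc_mean c (p b) - trunc_mean c (p 0) = gain c (p x) * (b - 0)"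
      by (rule has_derivative_mvt[OF order_refl b trunc_mean_has_derivative])
    have "real c + 1 = \<delta> * b" using \<delta> by (simp add: b_def)
    also have "\<dots> \<le> gain c (p x) * b" using b g[of x] x by (intro mult_right_mono) auto
    also have "\<dots> \<le> trunc_mean c (p b)" using x trunc_mean_nonneg[OF init, of c] by simp
    also have "\<dots> \<le> real c" using b by (intro trunc_mean_le prob) simp
    finally show False by simp
  qed
qed (auto intro: prob mean_conserved m trunc_mean_mono_time)

end

theorem theorem2:
  fixes p0 :: "nat \<Rightarrow> real" and r :: real
  assumes "prob_seq p0"
    and "r > 1"
    and "summable (\<lambda>k. real k powr r * p0 k)"
  shows "summable (\<lambda>k. real k * p0 k)
    \<and> ((\<lambda>n. l1norm (\<lambda>k. (R0 ^^ n) p0 k - limit_dist (\<Sum>j. real j * p0 j) k))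
          \<longlonglongrightarrow> 0)
    \<and> (\<forall>p :: real \<Rightarrow> nat \<Rightarrow> real.
          p 0 = p0 \<and> (\<forall>t\<ge>0. in_l1 (p t) \<and> has_l1_derivative p (\<lambda>k. R0 (p t) k - p t k) t)
          \<longrightarrow> ((\<lambda>t. l1norm (\<lambda>k. p t k - limit_dist (\<Sum>j. real j * p0 j) k)) \<longlongrightarrow> 0) at_top)"
proof -
  note nonneg = prob_seq_nonneg[OF assms(1)]
  have summable: "summable (\<lambda>k. real k * p0 k)"
  proof (rule summable_comparison_test[OF _ assms(3)], intro exI allI impI)
    fix k :: nat
    have "real k \<le> real k powr r"
      using powr_mono[of 1 r "real k"] assms(2) by (cases "k = 0") auto
    then show "norm (real k * p0 k) \<le> real k powr r * p0 k"
      by (simp add: nonneg mult_right_mono)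
  qed
  then have m: "((\<lambda>k. real k * p0 k) has_sum (\<Sum>j. real j * p0 j)) UNIV"
    by (intro sums_nonneg_imp_has_sum) (auto simp: nonneg summable_sums)
  show ?thesis
  proof (intro conjI allI impI summable discrete_convergence[OF assms(1) m])
    fix p :: "real \<Rightarrow> nat \<Rightarrow> real"
    assume p: "p 0 = p0 \<and> (\<forall>t\<ge>0. in_l1 (p t) \<and> has_l1_derivative p (\<lambda>k. R0 (p t) k - p t k) t)"
    then interpret l1_solution p
      using assms(1) by unfold_locales (auto simp: in_l1_iff_summable_on)
    show "((\<lambda>t. l1norm (\<lambda>k. p t k - limit_dist (\<Sum>j. real j * p0 j) k)) \<longlongrightarrow> 0) at_top"
      using convergence m p by simp
  qed
qed

end
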